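(* Let $(X,\xi)$ be a topological space and let $L=(\mathbb{P}X,\lim_\xi)$. Then $\mathrm{pt}'L$ is the sobrification ${}^{s}X$ of $X$: the map $[\mathcal U]\mapsto\lim_\xi\mathcal U$ is a homeomorphism from the convergence space $\mathrm{pt}'L$ onto the topological space ${}^{s}X$. Moreover, under this identification $e=q\circ h$, where $h:X\to\mathrm{pt}L$, $h(x)=\{x\}^{\uparrow}$, $q:\mathrm{pt}L\to\mathrm{pt}'L$ is the canonical surjection, and $e:X\to{}^{s}X$, $e(x)=\mathrm{cl}\{x\}$; and $e$ is a dense embedding whenever $(X,\xi)$ is $T_0$.
   Context: Filters on a set are proper. A convergence $\xi$ on a set $X$ assigns to each filter $\mathcal F$ on $X$ a set $\lim_\xi\mathcal F\subset X$ such that $\mathcal F\subset\mathcal G$ implies $\lim_\xi\mathcal F\subset\lim_\xi\mathcal G$, and $x\in\lim_\xi\{x\}^{\uparrow}$ for all $x$, where $\{x\}^{\uparrow}=\{A\subset X:x\in A\}$. A topology is regarded as a convergence by: $x\in\lim\mathcal F$ iff $\mathcal F$ contains the neighborhood filter of $x$. A map $f:(X,\xi)\to(Y,\tau)$ is continuous if $f(\lim_\xi\mathcal F)\subset\lim_\tau f[\mathcal F]$ for all filters $\mathcal F$, where $f[\mathcal F]=\{B\subset Y:f^{-1}(B)\in\mathcal F\}$; a homeomorphism is a bijection continuous in both directions. For $L=(\mathbb{P}X,\lim_\xi)$, $\mathrm{pt}L$ is the set of ultrafilters $\mathcal U$ on $X$ with $\lim_\xi\mathcal U\in\mathcal U$,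 with the convergence $\lim_{\mathrm{pt}L}\mathfrak F=(\lim_\xi\mathfrak F^{\circ})^{\bullet}$ for filters $\mathfrak F$ on $\mathrm{pt}L$, where $A^{\bullet}=\{\mathcal U\in\mathrm{pt}L:A\in\mathcal U\}$ for $A\subset X$ and $\mathfrak F^{\circ}=\{A\subset X:A^{\bullet}\in\mathfrak F\}$. Let $\sim$ be the equivalence relation on $\mathrm{pt}L$ with $\mathcal U\sim\mathcal W$ iff $\lim_\xi\mathcal U=\lim_\xi\mathcal W$. Then $\mathrm{pt}'L=\mathrm{pt}L/{\sim}$, with canonical surjection $q$, carries the quotient convergence $\lim_{\mathrm{pt}'L}\mathfrak H=\bigcup\{q(\lim_{\mathrm{pt}L}\mathfrak G):\mathfrak G\text{ a filter on }\mathrm{pt}L,\ q[\mathfrak G]\subset\mathfrak H\}$. The sobrification ${}^{s}X$ is the set of irreducible closed subsets of $X$ (nonempty closed $C$ such that $C\subset D\cup F$ with $D,F$ closed implies $C\subset D$ or $C\subset F$) with the topology $\{{}^{s}O: O\text{ open in }X\}$, where ${}^{s}O=\{C\in{}^{s}X:C\cap O\neq\emptyset\}$. A dense embedding is a homeomorphism onto a (topologically) dense subspace. *)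

theory Defs
  imports "HOL-Analysis.Analysis"
begin

section \<open>Convergences\<close>

text \<open>
  A filter on a set \<open>X\<close> is a library filter \<open>F \<noteq> bot\<close> with \<open>F \<le> principal X\<close>; a subset \<open>A\<close> of
  \<open>X\<close> belongs to it iff \<open>eventually (\<lambda>x. x \<in> A) F\<close>. The library orders filters by reverse inclusion,
  so that \<open>G \<le> F\<close> says that \<open>G\<close> contains \<open>F\<close> as a family of sets. The image filter is
  \<^const>\<open>filtermap\<close>, and \<open>principal {x}\<close> is the principal ultrafilter of \<open>x\<close>.
  The values of a limit operator matter only at filters on its carrier set.
\<close>

definition filter_on :: "'a set \<Rightarrow> 'a filter \<Rightarrow> bool" where
  "filter_on X F \<longleftrightarrow> F \<noteq> bot \<and> F \<le> principal X"

definition ultrafilter_on :: "'a set \<Rightarrow> 'a filter \<Rightarrow> bool" where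
  "ultrafilter_on X U \<longleftrightarrow> filter_on X U \<and> (\<forall>F. filter_on X F \<and> F \<le> U \<longrightarrow> F = U)"

definition convergence_on :: "'a set \<Rightarrow> ('a filter \<Rightarrow> 'a set) \<Rightarrow> bool" where
  "convergence_on X lm \<longleftrightarrow>
     (\<forall>F. filter_on X F \<longrightarrow> lm F \<subseteq> X) \<and>
     (\<forall>F G. filter_on X F \<and> filter_on X G \<and> G \<le> F \<longrightarrow> lm F \<subseteq> lm G) \<and>
     (\<forall>x\<in>X. x \<in> lm (principal {x}))"

definition conv_continuous ::
    "'a set \<Rightarrow> ('a filter \<Rightarrow> 'a set) \<Rightarrow> 'b set \<Rightarrow> ('b filter \<Rightarrow> 'b set) \<Rightarrow> ('a \<Rightarrow> 'b) \<Rightarrow> bool" where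
  "conv_continuous X lmX Y lmY f \<longleftrightarrow>
     f \<in> X \<rightarrow> Y \<and> (\<forall>F. filter_on X F \<longrightarrow> f ` lmX F \<subseteq> lmY (filtermap f F))"

definition conv_homeomorphism ::
    "'a set \<Rightarrow> ('a filter \<Rightarrow> 'a set) \<Rightarrow> 'b set \<Rightarrow> ('b filter \<Rightarrow> 'b set) \<Rightarrow> ('a \<Rightarrow> 'b) \<Rightarrow> bool" where
  "conv_homeomorphism X lmX Y lmY f \<longleftrightarrow>
     bij_betw f X Y \<and> conv_continuous X lmX Y lmY f \<and>
     conv_continuous Y lmY X lmX (inv_into X f)"

definition top_lim :: "'a topology \<Rightarrow> 'a filter \<Rightarrow> 'a set" where
  "top_lim T F = {x \<in> topspace T. F \<le> nhdsin T x}"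

definition quotient_lim ::
    "'a set \<Rightarrow> ('a filter \<Rightarrow> 'a set) \<Rightarrow> ('a \<Rightarrow> 'b) \<Rightarrow> 'b filter \<Rightarrow> 'b set" where
  "quotient_lim X lm q H = (\<Union>G\<in>{G. filter_on X G \<and> H \<le> filtermap q G}. q ` lm G)"


section \<open>The points of the powerset convergence lattice\<close>

definition pt :: "'a set \<Rightarrow> ('a filter \<Rightarrow> 'a set) \<Rightarrow> 'a filter set" where
  "pt X lm = {U. ultrafilter_on X U \<and> eventually (\<lambda>x. x \<in> lm U) U}"

definition bullet :: "'a set \<Rightarrow> ('a filter \<Rightarrow> 'a set) \<Rightarrow> 'a set \<Rightarrow> 'a filter set" where
  "bullet X lm A = {U \<in> pt X lm. eventually (\<lambda>x. x \<in> A) U}"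

text \<open>
  The filter of all subsets \<open>A\<close> of \<open>X\<close> whose \<open>bullet\<close> belongs to \<open>\<FF>\<close>;
  see \<open>eventually_circ_filter\<close> below.
\<close>

definition circ_filter :: "'a set \<Rightarrow> ('a filter \<Rightarrow> 'a set) \<Rightarrow> 'a filter filter \<Rightarrow> 'a filter" where
  "circ_filter X lm \<FF> = Abs_filter (\<lambda>P. eventually (\<lambda>U. U \<in> bullet X lm {x \<in> X. P x}) \<FF>)"

definition pt_lim :: "'a set \<Rightarrow> ('a filter \<Rightarrow> 'a set) \<Rightarrow> 'a filter filter \<Rightarrow> 'a filter set" where
  "pt_lim X lm \<FF> = bullet X lm (lm (circ_filter X lm \<FF>))"

definition pt_rel :: "'a set \<Rightarrow> ('a filter \<Rightarrow> 'a set) \<Rightarrow> ('a filter \<times> 'a filter) set" where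
  "pt_rel X lm = {(U, W). U \<in> pt X lm \<and> W \<in> pt X lm \<and> lm U = lm W}"

definition pt_proj :: "'a set \<Rightarrow> ('a filter \<Rightarrow> 'a set) \<Rightarrow> 'a filter \<Rightarrow> 'a filter set" where
  "pt_proj X lm U = pt_rel X lm `` {U}"

definition pt' :: "'a set \<Rightarrow> ('a filter \<Rightarrow> 'a set) \<Rightarrow> 'a filter set set" where
  "pt' X lm = pt X lm // pt_rel X lm"

definition pt'_lim ::
    "'a set \<Rightarrow> ('a filter \<Rightarrow> 'a set) \<Rightarrow> 'a filter set filter \<Rightarrow> 'a filter set set" where
  "pt'_lim X lm = quotient_lim (pt X lm) (pt_lim X lm) (pt_proj X lm)"


section \<open>The sobrification and dense embeddings\<close>

definition irreducible_closed :: "'a topology \<Rightarrow> 'a set \<Rightarrow> bool" where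
  "irreducible_closed T C \<longleftrightarrow> closedin T C \<and> C \<noteq> {} \<and>
     (\<forall>D F. closedin T D \<and> closedin T F \<and> C \<subseteq> D \<union> F \<longrightarrow> C \<subseteq> D \<or> C \<subseteq> F)"

definition sob_open :: "'a topology \<Rightarrow> 'a set \<Rightarrow> 'a set set" where
  "sob_open T V = {C. irreducible_closed T C \<and> C \<inter> V \<noteq> {}}"

definition sobrification :: "'a topology \<Rightarrow> 'a set topology" where
  "sobrification T = topology (\<lambda>W. \<exists>V. openin T V \<and> W = sob_open T V)"

definition dense_embedding :: "'a topology \<Rightarrow> 'b topology \<Rightarrow> ('a \<Rightarrow> 'b) \<Rightarrow> bool" where
  "dense_embedding S T f \<longleftrightarrow>
     embedding_map S T f \<and> T closure_of (f ` topspace S) = topspace T"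


section \<open>Basic facts\<close>

lemma eventually_circ_filter:
  assumes "\<FF> \<le> principal (pt X lm)"
  shows "eventually P (circ_filter X lm \<FF>) \<longleftrightarrow>
         eventually (\<lambda>U. U \<in> bullet X lm {x \<in> X. P x}) \<FF>"
  unfolding circ_filter_def
proof (rule eventually_Abs_filter, rule is_filter.intro)
  have X: "eventually (\<lambda>x. x \<in> X) U" if "U \<in> pt X lm" for U
    using that by (simp add: pt_def ultrafilter_on_def filter_on_def le_principal)
  show "eventually (\<lambda>U. U \<in> bullet X lm {x \<in> X. True}) \<FF>"
    using assms X by (auto simp: le_principal bullet_def elim: eventually_mono)
next
  fix P Q :: "'a \<Rightarrow> bool"
  assume "eventually (\<lambda>U. U \<in> bullet X lm {x \<in> X. P x}) \<FF>"
    and "eventually (\<lambda>U. U \<in> bullet X lm {x \<in> X. Q x}) \<FF>"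
  then show "eventually (\<lambda>U. U \<in> bullet X lm {x \<in> X. P x \<and> Q x}) \<FF>"
    by eventually_elim (auto simp: bullet_def eventually_conj_iff)
next
  fix P Q :: "'a \<Rightarrow> bool"
  assume PQ: "\<forall>x. P x \<longrightarrow> Q x"
    and "eventually (\<lambda>U. U \<in> bullet X lm {x \<in> X. P x}) \<FF>"
  from this(2) show "eventually (\<lambda>U. U \<in> bullet X lm {x \<in> X. Q x}) \<FF>"
    by eventually_elim (use PQ in \<open>auto simp: bullet_def elim: eventually_mono\<close>)
qed

lemma filter_on_principal [simp]: "filter_on X (principal {x}) \<longleftrightarrow> x \<in> X"
  by (auto simp: filter_on_def principal_eq_bot_iff)

lemma filter_on_circ_filter:
  assumes "filter_on (pt X lm) \<FF>"
  shows "filter_on X (circ_filter X lm \<FF>)"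
proof -
  have le: "\<FF> \<le> principal (pt X lm)" and nb: "\<FF> \<noteq> bot"
    using assms by (auto simp: filter_on_def)
  have "\<not> eventually (\<lambda>x. False) (circ_filter X lm \<FF>)"
  proof
    assume "eventually (\<lambda>x. False) (circ_filter X lm \<FF>)"
    then have "eventually (\<lambda>U. U \<in> bullet X lm {}) \<FF>"
      by (simp add: eventually_circ_filter[OF le])
    moreover have "bullet X lm {} = {}"
      by (auto simp: bullet_def pt_def ultrafilter_on_def filter_on_def trivial_limit_def)
    ultimately show False using nb by (simp add: trivial_limit_def)
  qed
  moreover have "eventually (\<lambda>U. U \<in> bullet X lm {x \<in> X. x \<in> X}) \<FF>"
    using le unfolding le_principal
    by (rule eventually_mono)
      (auto simp: bullet_def pt_def ultrafilter_on_def filter_on_def le_principal)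
  ultimately show ?thesis
    by (auto simp: filter_on_def le_principal trivial_limit_def eventually_circ_filter[OF le])
qed

lemma convergence_on_top_lim: "convergence_on (topspace T) (top_lim T)"
  unfolding convergence_on_def
proof (intro conjI allI impI ballI)
  fix F :: "'a filter" show "top_lim T F \<subseteq> topspace T" by (auto simp: top_lim_def)
next
  fix F G :: "'a filter" assume "filter_on (topspace T) F \<and> filter_on (topspace T) G \<and> G \<le> F"
  then show "top_lim T F \<subseteq> top_lim T G" unfolding top_lim_def by (blast intro: order_trans)
next
  fix x assume "x \<in> topspace T"
  then show "x \<in> top_lim T (principal {x})"
    by (auto simp: top_lim_def le_filter_def eventually_nhdsin eventually_principal)
qed

lemma convergence_on_pt_lim:
  assumes "convergence_on X lm"
  shows "convergence_on (pt X lm) (pt_lim X lm)"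
  unfolding convergence_on_def
proof (intro conjI allI impI ballI)
  fix F show "pt_lim X lm F \<subseteq> pt X lm" by (auto simp: pt_lim_def bullet_def)
next
  fix F G assume a: "filter_on (pt X lm) F \<and> filter_on (pt X lm) G \<and> G \<le> F"
  then have "circ_filter X lm G \<le> circ_filter X lm F"
    unfolding le_filter_def[of "circ_filter X lm G"]
    by (simp add: filter_on_def eventually_circ_filter) (blast intro: filter_leD)
  with a assms have "lm (circ_filter X lm F) \<subseteq> lm (circ_filter X lm G)"
    by (auto simp: convergence_on_def filter_on_circ_filter)
  then show "pt_lim X lm F \<subseteq> pt_lim X lm G"
    unfolding pt_lim_def bullet_def by (blast intro: eventually_mono)
next
  fix U assume U: "U \<in> pt X lm"
  then have X: "eventually (\<lambda>x. x \<in> X) U"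
    by (simp add: pt_def ultrafilter_on_def filter_on_def le_principal)
  have "circ_filter X lm (principal {U}) = U"
    using U X by (auto simp: filter_eq_iff eventually_circ_filter eventually_principal bullet_def
        eventually_conj_iff)
  with U show "U \<in> pt_lim X lm (principal {U})"
    by (simp add: pt_lim_def bullet_def pt_def)
qed

lemma convergence_on_quotient_lim:
  assumes "convergence_on X lm" and "q ` X = Y"
  shows "convergence_on Y (quotient_lim X lm q)"
  unfolding convergence_on_def
proof (intro conjI allI impI ballI)
  fix F show "quotient_lim X lm q F \<subseteq> Y"
    using assms by (auto simp: quotient_lim_def convergence_on_def)
next
  fix F G assume "filter_on Y F \<and> filter_on Y G \<and> G \<le> F"
  then show "quotient_lim X lm q F \<subseteq> quotient_lim X lm q G"
    unfolding quotient_lim_def by (blast intro: order_trans)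
next
  fix y assume "y \<in> Y"
  then obtain x where x: "x \<in> X" "y = q x" using assms(2) by auto
  then have "x \<in> lm (principal {x})" using assms(1) by (auto simp: convergence_on_def)
  with x show "y \<in> quotient_lim X lm q (principal {y})"
    unfolding quotient_lim_def by (intro UN_I[of "principal {x}"]) (auto simp: filtermap_principal)
qed

lemma equiv_pt_rel: "equiv (pt X lm) (pt_rel X lm)"
  by (auto simp: equiv_def refl_on_def sym_def trans_def pt_rel_def)

lemma pt_proj_image: "pt_proj X lm ` pt X lm = pt' X lm"
  by (auto simp: pt_proj_def pt'_def quotient_def)

lemma convergence_on_pt'_lim:
  "convergence_on X lm \<Longrightarrow> convergence_on (pt' X lm) (pt'_lim X lm)"
  unfolding pt'_lim_def
  by (intro convergence_on_quotient_lim convergence_on_pt_lim pt_proj_image)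

lemma sob_open_Int:
  assumes "openin T V" "openin T W"
  shows "sob_open T V \<inter> sob_open T W = sob_open T (V \<inter> W)"
proof -
  have "C \<inter> (V \<inter> W) \<noteq> {}"
    if C: "irreducible_closed T C" and V: "C \<inter> V \<noteq> {}" and W: "C \<inter> W \<noteq> {}" for C
  proof
    assume "C \<inter> (V \<inter> W) = {}"
    moreover have "C \<subseteq> topspace T"
      using C by (simp add: irreducible_closed_def closedin_subset)
    ultimately have "C \<subseteq> (topspace T - V) \<union> (topspace T - W)" by blast
    moreover have "closedin T (topspace T - V)" "closedin T (topspace T - W)"
      using assms by auto
    ultimately have "C \<subseteq> topspace T - V \<or> C \<subseteq> topspace T - W"
      using C unfolding irreducible_closed_def by blast
    with V W show False by blast
  qed
  then show ?thesis by (auto simp: sob_open_def)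
qed

lemma sob_open_Union: "\<Union> (sob_open T ` \<V>) = sob_open T (\<Union>\<V>)"
  by (auto simp: sob_open_def)

lemma istopology_sobrification: "istopology (\<lambda>W. \<exists>V. openin T V \<and> W = sob_open T V)"
  unfolding istopology_def
proof (intro conjI allI impI)
  fix S S' assume "\<exists>V. openin T V \<and> S = sob_open T V" "\<exists>V. openin T V \<and> S' = sob_open T V"
  then show "\<exists>V. openin T V \<and> S \<inter> S' = sob_open T V"
    by (metis sob_open_Int openin_Int)
next
  fix \<K> assume "\<forall>K\<in>\<K>. \<exists>V. openin T V \<and> K = sob_open T V"
  then obtain v where v: "\<forall>K\<in>\<K>. openin T (v K) \<and> K = sob_open T (v K)" by metis
  then have "sob_open T ` v ` \<K> = \<K>" by force
  then have "\<Union>\<K> = \<Union> (sob_open T ` v ` \<K>)" by (rule arg_cong[OF sym])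
  also have "\<dots> = sob_open T (\<Union> (v ` \<K>))" by (rule sob_open_Union)
  finally have "\<Union>\<K> = sob_open T (\<Union> (v ` \<K>))" .
  moreover have "openin T (\<Union> (v ` \<K>))" using v by (intro openin_Union) auto
  ultimately show "\<exists>V. openin T V \<and> \<Union>\<K> = sob_open T V" by blast
qed

lemma openin_sobrification:
  "openin (sobrification T) W \<longleftrightarrow> (\<exists>V. openin T V \<and> W = sob_open T V)"
  by (simp add: sobrification_def topology_inverse'[OF istopology_sobrification])

lemma topspace_sobrification: "topspace (sobrification T) = {C. irreducible_closed T C}"
proof (rule equalityI)
  show "topspace (sobrification T) \<subseteq> {C. irreducible_closed T C}"
    by (auto simp: topspace_def openin_sobrification sob_open_def)
  have "sob_open T (topspace T) = {C. irreducible_closed T C}"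
    using closedin_subset by (fastforce simp: sob_open_def irreducible_closed_def)
  moreover have "openin (sobrification T) (sob_open T (topspace T))"
    by (auto simp: openin_sobrification)
  ultimately show "{C. irreducible_closed T C} \<subseteq> topspace (sobrification T)"
    by (metis openin_subset)
qed

end

theory Submission
  imports Defs
begin

text \<open>
  Let \<open>\<U>\<close> be an ultrafilter on a topological space with \<open>C = lim \<U> \<in> \<U>\<close>. An open set \<open>O\<close> belongs to
  \<open>\<U>\<close> iff it meets \<open>C\<close>: if \<open>O \<in> \<U>\<close> then \<open>O \<inter> C \<in> \<U>\<close> is nonempty, and if \<open>O\<close> contains a limit of \<open>\<U>\<close>
  then \<open>O \<in> \<U>\<close>. So the open sets in \<open>\<U>\<close> carry the same information as \<open>C\<close>, and \<open>C\<close> inherits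
  irreducibility from the primality of \<open>\<U>\<close>. Conversely, for an irreducible closed set \<open>C\<close> the traces
  on \<open>C\<close> of the open sets that meet \<open>C\<close> form a filter base, and every ultrafilter that contains
  this base has \<open>C\<close> as its limit set. Hence \<open>\<U> \<mapsto> lim \<U>\<close> maps the points onto the sobrification
  (\<open>irreducible_closed_top_lim\<close>, \<open>irreducible_closed_is_top_lim\<close>), and two points have the same image
  iff they are identified in the quotient.

  For the convergences, the same equivalence says that the set of points to which \<open>O\<close> belongs is the
  preimage under \<open>lim\<close> of the basic open set of \<open>O\<close>. It follows (\<open>mem_pt_lim_iff\<close>) that a filter
  \<open>\<FF>\<close> of points converges to \<open>\<U>\<close> iff its image under \<open>lim\<close> converges to \<open>lim \<U>\<close> in the
  sobrification: the points carry the initial convergence of the map \<open>lim\<close>. An initial convergence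
  along a surjection pushes forward to the convergence it came from, because any filter on the target
  lifts along a set-theoretic section (\<open>conv_homeomorphism_quotient_of_initial\<close>); this makes the
  quotient homeomorphic to the sobrification.

  The point closure map is a dense embedding in the T0 case because the closure of \<open>x\<close> meets an open
  set \<open>O\<close> iff \<open>x \<in> O\<close>.
\<close>

section \<open>Limits of a filter in a topological space\<close>

lemma mem_top_lim_iff:
  "x \<in> top_lim T F \<longleftrightarrow>
     x \<in> topspace T \<and> (\<forall>V. openin T V \<and> x \<in> V \<longrightarrow> eventually (\<lambda>y. y \<in> V) F)"
proof -
  have "F \<le> nhdsin T x \<longleftrightarrow> (\<forall>V. openin T V \<and> x \<in> V \<longrightarrow> eventually (\<lambda>y. y \<in> V) F)" (is "?L \<longleftrightarrow> ?R")
    if x: "x \<in> topspace T"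
  proof
    assume ?L
    then show ?R by (auto intro!: filter_leD[of F] simp: eventually_nhdsin)
  next
    assume R: ?R
    show ?L
    proof (rule filter_leI)
      fix P assume "eventually P (nhdsin T x)"
      then obtain V where "openin T V" "x \<in> V" and V: "\<forall>y\<in>V. P y"
        using x by (auto simp: eventually_nhdsin)
      with R have "eventually (\<lambda>y. y \<in> V) F" by blast
      then show "eventually P F" by (rule eventually_mono) (use V in blast)
    qed
  qed
  then show ?thesis by (auto simp: top_lim_def)
qed

lemma closedin_top_lim: "closedin T (top_lim T F)"
proof -
  have "T closure_of top_lim T F \<subseteq> top_lim T F"
  proof
    fix x assume x: "x \<in> T closure_of top_lim T F"
    have "eventually (\<lambda>y. y \<in> V) F" if V: "openin T V" "x \<in> V" for V
    proof -
      obtain y where "y \<in> top_lim T F" "y \<in> V" using x V unfolding in_closure_of by blast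
      with V(1) show ?thesis unfolding mem_top_lim_iff by blast
    qed
    with x show "x \<in> top_lim T F" unfolding mem_top_lim_iff in_closure_of by blast
  qed
  moreover have "top_lim T F \<subseteq> topspace T" by (auto simp: top_lim_def)
  ultimately show ?thesis using closure_of_subset_eq by blast
qed

lemma top_lim_subset_closed:
  assumes "closedin T D" "eventually (\<lambda>x. x \<in> D) F" "F \<noteq> bot"
  shows "top_lim T F \<subseteq> D"
proof (rule subsetI, rule ccontr)
  fix x assume x: "x \<in> top_lim T F" "x \<notin> D"
  then have "eventually (\<lambda>y. y \<in> topspace T - D) F"
    using openin_diff[OF openin_topspace assms(1)] unfolding mem_top_lim_iff by blast
  with assms(2) have "eventually (\<lambda>y. False) F" by eventually_elim auto
  with assms(3) show False by (simp add: trivial_limit_def)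
qed

lemma top_lim_principal:
  assumes "x \<in> topspace T" shows "top_lim T (principal {x}) = T closure_of {x}"
  unfolding set_eq_iff mem_top_lim_iff in_closure_of eventually_principal by blast

section \<open>Ultrafilters on a set\<close>

lemma ultrafilter_onD:
  assumes "ultrafilter_on X U"
  shows "U \<noteq> bot" "eventually (\<lambda>x. x \<in> X) U"
  using assms by (auto simp: ultrafilter_on_def filter_on_def le_principal)

text \<open>
  If the complement of \<open>P\<close> is not in \<open>U\<close>, then \<open>P\<close> can be adjoined to \<open>U\<close>, and maximality says that it
  was there already.
\<close>

lemma ultrafilter_on_dichotomy:
  assumes "ultrafilter_on X U"
  shows "eventually P U \<or> eventually (\<lambda>x. \<not> P x) U"
proof (rule disjCI)
  assume "\<not> eventually (\<lambda>x. \<not> P x) U"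
  then have "inf U (principal {x. P x}) \<noteq> bot"
    by (simp add: trivial_limit_def eventually_inf_principal)
  then have "inf U (principal {x. P x}) = U"
    using assms by (simp add: ultrafilter_on_def filter_on_def le_infI1)
  then have "U \<le> principal {x. P x}" by (simp add: inf.absorb_iff1)
  then show "eventually P U" by (simp add: le_principal)
qed

lemma ultrafilter_on_principal:
  assumes "x \<in> X" shows "ultrafilter_on X (principal {x})"
  unfolding ultrafilter_on_def
proof (intro conjI allI impI)
  fix F assume F: "filter_on X F \<and> F \<le> principal {x}"
  show "F = principal {x}"
  proof (rule antisym)
    have ev: "eventually (\<lambda>y. y = x) F" using F by (simp add: le_principal)
    have "P x" if "eventually P F" for P
    proof (rule ccontr)
      assume "\<not> P x"
      have "eventually (\<lambda>_. False) F" using ev that by eventually_elim (use \<open>\<not> P x\<close> in auto)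
      with F show False by (simp add: filter_on_def trivial_limit_def)
    qed
    then show "principal {x} \<le> F"
      unfolding le_filter_def eventually_principal by blast
  qed (use F in simp)
qed (use assms in simp)

text \<open>
  Zorn's lemma for proper filters finer than \<open>F\<close>: the infimum of a chain is proper because the
  infimum of a finite nonempty part of the chain is one of its members.
\<close>

lemma ultrafilter_on_exists:
  assumes "filter_on X F"
  obtains U where "ultrafilter_on X U" "U \<le> F"
proof -
  define A where "A = {G. G \<noteq> bot \<and> G \<le> F}"
  have "\<exists>U\<in>A. \<forall>G\<in>A. U \<ge> G \<longrightarrow> G = U"
  proof (rule predicate_Zorn)
    show "partial_order_on A (relation_of (\<ge>) A)"
      by (rule partial_order_on_relation_ofI) auto
  next
    fix C assume C: "C \<in> Chains (relation_of (\<ge>) A)"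
    then have sub: "C \<subseteq> A" and lin: "\<And>G H. G \<in> C \<Longrightarrow> H \<in> C \<Longrightarrow> G \<le> H \<or> H \<le> G"
      by (auto simp: Chains_def relation_of_def)
    show "\<exists>u\<in>A. \<forall>a\<in>C. a \<ge> u"
    proof (cases "C = {}")
      case True
      have "F \<in> A" using assms by (simp add: A_def filter_on_def)
      then show ?thesis using True by blast
    next
      case False
      have fin: "Inf B \<in> C" if "finite B" "B \<noteq> {}" "B \<subseteq> C" for B
        using that
      proof (induction B rule: finite_ne_induct)
        case (insert G B)
        then have "Inf B \<in> C" "G \<in> C" by auto
        then show ?case using lin[of G "Inf B"] by (auto simp: inf.absorb1 inf.absorb2)
      qed simp
      have top: "(top :: 'a filter) \<noteq> bot"
        using assms top_greatest[of F] bot_unique[of F] unfolding filter_on_def by metis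
      have "Inf C \<noteq> bot"
      proof (rule Inf_filter_not_bot)
        fix B assume "B \<subseteq> C" "finite B"
        then show "Inf B \<noteq> bot"
          using fin[of B] sub top by (cases "B = {}") (auto simp: A_def)
      qed
      moreover obtain G where "G \<in> C" using False by blast
      ultimately have "Inf C \<in> A"
        using sub by (auto simp: A_def intro: Inf_lower2)
      then show ?thesis by (blast intro: Inf_lower)
    qed
  qed
  then obtain U where U: "U \<in> A" "\<And>G. G \<in> A \<Longrightarrow> G \<le> U \<Longrightarrow> G = U" by blast
  have "ultrafilter_on X U"
    using U assms by (auto simp: ultrafilter_on_def filter_on_def A_def)
  with U(1) show thesis by (intro that[of U]) (auto simp: A_def)
qed

section \<open>Points and irreducible closed sets\<close>

abbreviation top_pt :: "'a topology \<Rightarrow> 'a filter set" where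
  "top_pt T \<equiv> pt (topspace T) (top_lim T)"

text \<open>
  If the limit set \<open>C \<in> U\<close> is covered by two closed sets, then one of them belongs to \<open>U\<close>; a closed
  set that belongs to \<open>U\<close> contains every limit of \<open>U\<close>.
\<close>

lemma irreducible_closed_top_lim:
  assumes "U \<in> top_pt T"
  shows "irreducible_closed T (top_lim T U)"
  unfolding irreducible_closed_def
proof (intro conjI allI impI)
  have U: "ultrafilter_on (topspace T) U" and C: "eventually (\<lambda>x. x \<in> top_lim T U) U"
    using assms by (auto simp: pt_def)
  note nb = ultrafilter_onD(1)[OF U]
  show "closedin T (top_lim T U)" by (rule closedin_top_lim)
  show "top_lim T U \<noteq> {}"
    using C nb by (auto simp: trivial_limit_def)
  fix D F assume DF: "closedin T D \<and> closedin T F \<and> top_lim T U \<subseteq> D \<union> F"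
  show "top_lim T U \<subseteq> D \<or> top_lim T U \<subseteq> F"
    using ultrafilter_on_dichotomy[OF U, of "\<lambda>x. x \<in> D"]
  proof
    assume "eventually (\<lambda>x. x \<in> D) U"
    with DF nb have "top_lim T U \<subseteq> D" by (simp add: top_lim_subset_closed)
    then show ?thesis ..
  next
    assume "eventually (\<lambda>x. x \<notin> D) U"
    with C have "eventually (\<lambda>x. x \<in> F) U" by eventually_elim (use DF in auto)
    with DF nb have "top_lim T U \<subseteq> F" by (simp add: top_lim_subset_closed)
    then show ?thesis ..
  qed
qed

text \<open>
  Irreducibility says that the intersection of two open sets meeting \<open>C\<close> again meets \<open>C\<close>, so their
  traces on \<open>C\<close> generate a proper filter. A finer ultrafilter converges to every element of \<open>C\<close> by
  construction and to nothing else since it contains the closed set \<open>C\<close>.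
\<close>

lemma irreducible_closed_is_top_lim:
  assumes C: "irreducible_closed T C"
  obtains U where "U \<in> top_pt T" "top_lim T U = C"
proof -
  let ?\<V> = "{V. openin T V \<and> C \<inter> V \<noteq> {}}"
  let ?F = "INF V\<in>?\<V>. principal (C \<inter> V)"
  have clo: "closedin T C" and ne: "C \<noteq> {}" and sub: "C \<subseteq> topspace T"
    using C by (auto simp: irreducible_closed_def closedin_subset)
  have "?F \<noteq> bot"
  proof (subst INF_filter_bot_base)
    fix V W assume VW: "V \<in> ?\<V>" "W \<in> ?\<V>"
    then have "C \<in> sob_open T V \<inter> sob_open T W" using C by (simp add: sob_open_def)
    then have "C \<in> sob_open T (V \<inter> W)" using VW sob_open_Int[of T V W] by blast
    with VW show "\<exists>Z\<in>?\<V>. principal (C \<inter> Z) \<le> inf (principal (C \<inter> V)) (principal (C \<inter> W))"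
      by (intro bexI[of _ "V \<inter> W"]) (auto simp: sob_open_def)
  qed (auto simp: principal_eq_bot_iff)
  \<comment> \<open>The whole space meets \<open>C\<close>, so \<open>C\<close> itself is one of the traces.\<close>
  moreover have "topspace T \<in> ?\<V>" using sub ne by auto
  then have "?F \<le> principal C"
    by (rule INF_lower2) auto
  ultimately obtain U where U: "ultrafilter_on (topspace T) U" "U \<le> ?F"
    using sub ultrafilter_on_exists[of "topspace T" ?F]
    by (auto simp: filter_on_def intro: order_trans)
  from U(2) \<open>?F \<le> principal C\<close> have evC: "eventually (\<lambda>x. x \<in> C) U"
    by (auto simp: le_principal intro: filter_leD)
  have lim: "top_lim T U = C"
  proof
    show "top_lim T U \<subseteq> C"
      using clo evC ultrafilter_onD(1)[OF U(1)] by (rule top_lim_subset_closed)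
    show "C \<subseteq> top_lim T U"
    proof
      fix x assume x: "x \<in> C"
      have "eventually (\<lambda>y. y \<in> V) U" if "openin T V" "x \<in> V" for V
      proof -
        have "?F \<le> principal (C \<inter> V)" using that x by (intro INF_lower) auto
        with U(2) have "U \<le> principal (C \<inter> V)" by (rule order_trans)
        then show ?thesis by (auto simp: le_principal elim: eventually_mono)
      qed
      with x sub show "x \<in> top_lim T U" by (auto simp: mem_top_lim_iff)
    qed
  qed
  show thesis by (rule that[of U]) (use U evC lim in \<open>auto simp: pt_def\<close>)
qed

text \<open>
  The limit set of a point determines its open members. Everything about the convergence of points
  rests on this equivalence.
\<close>

lemma eventually_open_iff_meets_top_lim:
  assumes "U \<in> top_pt T" "openin T V"
  shows "eventually (\<lambda>x. x \<in> V) U \<longleftrightarrow> top_lim T U \<in> sob_open T V"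
proof
  have U: "ultrafilter_on (topspace T) U" and C: "eventually (\<lambda>x. x \<in> top_lim T U) U"
    using assms by (auto simp: pt_def)
  assume "eventually (\<lambda>x. x \<in> V) U"
  with C have "eventually (\<lambda>x. x \<in> top_lim T U \<inter> V) U" by eventually_elim auto
  then have "top_lim T U \<inter> V \<noteq> {}"
    using ultrafilter_onD(1)[OF U] eventually_happens by blast
  then show "top_lim T U \<in> sob_open T V"
    using irreducible_closed_top_lim[OF assms(1)] by (simp add: sob_open_def)
next
  assume "top_lim T U \<in> sob_open T V"
  then show "eventually (\<lambda>x. x \<in> V) U"
    using assms(2) by (auto simp: sob_open_def mem_top_lim_iff)
qed

section \<open>Convergence of points is initial for the limit map\<close>

lemma eventually_open_circ_filter:
  assumes "filter_on (top_pt T) \<FF>" "openin T V"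
  shows "eventually (\<lambda>x. x \<in> V) (circ_filter (topspace T) (top_lim T) \<FF>) \<longleftrightarrow>
         eventually (\<lambda>C. C \<in> sob_open T V) (filtermap (top_lim T) \<FF>)"
proof -
  have pt: "eventually (\<lambda>U. U \<in> top_pt T) \<FF>" and le: "\<FF> \<le> principal (top_pt T)"
    using assms(1) by (auto simp: filter_on_def le_principal)
  have V: "{x \<in> topspace T. x \<in> V} = V" using openin_subset[OF assms(2)] by auto
  have "eventually (\<lambda>x. x \<in> V) (circ_filter (topspace T) (top_lim T) \<FF>) \<longleftrightarrow>
        eventually (\<lambda>U. U \<in> bullet (topspace T) (top_lim T) V) \<FF>"
    unfolding eventually_circ_filter[OF le] V ..
  also have "\<dots> \<longleftrightarrow> eventually (\<lambda>U. top_lim T U \<in> sob_open T V) \<FF>"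
    by (rule eventually_cong[OF pt])
      (auto simp: bullet_def eventually_open_iff_meets_top_lim[OF _ assms(2)])
  finally show ?thesis by (simp add: eventually_filtermap)
qed

text \<open>
  Both sides say that \<open>lim U\<close> is contained in the limit set of the \<open>circ_filter\<close> of \<open>\<FF>\<close>. On the left,
  that limit set is closed, so it belongs to \<open>U\<close> iff it contains \<open>lim U\<close>. On the right, the basic open
  sets around \<open>lim U\<close> come from the open sets meeting \<open>lim U\<close>, and these are the open
  neighborhoods of its elements.
\<close>

lemma mem_pt_lim_iff:
  assumes U: "U \<in> top_pt T" and \<FF>: "filter_on (top_pt T) \<FF>"
  shows "U \<in> pt_lim (topspace T) (top_lim T) \<FF> \<longleftrightarrow>
         top_lim T U \<in> top_lim (sobrification T) (filtermap (top_lim T) \<FF>)"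
proof -
  let ?F = "circ_filter (topspace T) (top_lim T) \<FF>"
  have C: "eventually (\<lambda>x. x \<in> top_lim T U) U" using U by (simp add: pt_def)
  have "U \<in> pt_lim (topspace T) (top_lim T) \<FF> \<longleftrightarrow>
        eventually (\<lambda>x. x \<in> top_lim T ?F) U"
    using U by (simp add: pt_lim_def bullet_def)
  also have "\<dots> \<longleftrightarrow> top_lim T U \<subseteq> top_lim T ?F"
  proof
    assume "eventually (\<lambda>x. x \<in> top_lim T ?F) U"
    then show "top_lim T U \<subseteq> top_lim T ?F"
      using U by (intro top_lim_subset_closed closedin_top_lim)
        (auto simp: pt_def dest: ultrafilter_onD)
  qed (use C in \<open>auto elim: eventually_mono\<close>)
  also have "\<dots> \<longleftrightarrow> (\<forall>V. openin T V \<and> top_lim T U \<in> sob_open T V \<longrightarrow>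
                          eventually (\<lambda>x. x \<in> V) ?F)"
  proof -
    have "top_lim T U \<subseteq> topspace T" by (rule closedin_subset[OF closedin_top_lim])
    moreover have "top_lim T U \<in> sob_open T V \<longleftrightarrow> (\<exists>x\<in>top_lim T U. x \<in> V)" for V
      using irreducible_closed_top_lim[OF U] by (auto simp: sob_open_def)
    ultimately show ?thesis
      unfolding subset_iff mem_top_lim_iff[of _ T ?F] by blast
  qed
  also have "\<dots> \<longleftrightarrow> top_lim T U \<in> top_lim (sobrification T) (filtermap (top_lim T) \<FF>)"
    using irreducible_closed_top_lim[OF U]
    by (auto simp: mem_top_lim_iff[of _ "sobrification T"] openin_sobrification
        topspace_sobrification eventually_open_circ_filter[OF \<FF>])
  finally show ?thesis .
qed

section \<open>Quotients of initial convergences\<close>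

lemma filtermap_cong_eventually:
  assumes "eventually (\<lambda>x. f x = g x) F"
  shows "filtermap f F = filtermap g F"
  unfolding filter_eq_iff eventually_filtermap
  by (intro allI eventually_cong[OF assms]) simp

lemma filter_on_filtermap:
  assumes "filter_on X F" "f \<in> X \<rightarrow> Y" shows "filter_on Y (filtermap f F)"
proof -
  have "eventually (\<lambda>x. f x \<in> Y) F"
    by (rule eventually_mono[of "\<lambda>x. x \<in> X"])
      (use assms in \<open>auto simp: filter_on_def le_principal\<close>)
  with assms(1) show ?thesis
    by (simp add: filter_on_def filtermap_bot_iff le_principal eventually_filtermap)
qed

text \<open>
  The hypothesis \<open>initial\<close> makes \<open>lmX\<close> the initial convergence of \<open>\<phi> \<circ> q\<close>. Continuity of \<open>\<phi>\<close> is then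
  immediate. For the inverse, a filter \<open>H\<close> on \<open>Y\<close> is lifted to \<open>X\<close> by a section \<open>s\<close> of \<open>\<phi> \<circ> q\<close>, which
  need not be continuous: the lift converges as soon as its image \<open>H\<close> does.
\<close>

lemma conv_homeomorphism_quotient_of_initial:
  assumes Y: "convergence_on Y lmY" and X: "convergence_on X lmX"
    and q: "q ` X = Z" and bij: "bij_betw \<phi> Z Y"
    and initial: "\<And>x F. x \<in> X \<Longrightarrow> filter_on X F \<Longrightarrow>
      x \<in> lmX F \<longleftrightarrow> \<phi> (q x) \<in> lmY (filtermap (\<lambda>x. \<phi> (q x)) F)"
  shows "conv_homeomorphism Z (quotient_lim X lmX q) Y lmY \<phi>"
  unfolding conv_homeomorphism_def conv_continuous_def
proof (intro conjI allI impI bij)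
  show \<phi>: "\<phi> \<in> Z \<rightarrow> Y" using bij by (auto simp: bij_betw_def)
  show "inv_into Z \<phi> \<in> Y \<rightarrow> Z" using bij_betw_inv_into[OF bij] by (auto simp: bij_betw_def)
  fix H assume H: "filter_on Z H"
  show "\<phi> ` quotient_lim X lmX q H \<subseteq> lmY (filtermap \<phi> H)"
  proof
    fix y assume "y \<in> \<phi> ` quotient_lim X lmX q H"
    then obtain G x where G: "filter_on X G" "H \<le> filtermap q G" "x \<in> lmX G" "y = \<phi> (q x)"
      by (auto simp: quotient_lim_def)
    have "x \<in> X" using X G by (auto simp: convergence_on_def)
    with G initial have "y \<in> lmY (filtermap (\<lambda>x. \<phi> (q x)) G)" by blast
    moreover have "filtermap \<phi> H \<le> filtermap (\<lambda>x. \<phi> (q x)) G"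
      using filtermap_mono[OF G(2), of \<phi>] by (simp add: filtermap_filtermap)
    moreover have "filter_on Y (filtermap \<phi> H)" using H \<phi> by (rule filter_on_filtermap)
    moreover have "filter_on Y (filtermap (\<lambda>x. \<phi> (q x)) G)"
      using G(1) by (rule filter_on_filtermap) (use q \<phi> in auto)
    ultimately show "y \<in> lmY (filtermap \<phi> H)" using Y unfolding convergence_on_def by blast
  qed
next
  fix H assume H: "filter_on Y H"
  have "\<forall>y\<in>Y. \<exists>x\<in>X. \<phi> (q x) = y" using q bij by (force simp: bij_betw_def)
  then obtain s where s: "\<And>y. y \<in> Y \<Longrightarrow> s y \<in> X" "\<And>y. y \<in> Y \<Longrightarrow> \<phi> (q (s y)) = y" by metis
  have inv: "inv_into Z \<phi> y = q (s y)" if "y \<in> Y" for y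
    using s[OF that] q bij by (metis bij_betw_def image_eqI inv_into_f_f)
  have evY: "eventually (\<lambda>y. y \<in> Y) H" using H by (simp add: filter_on_def le_principal)
  let ?G = "filtermap s H"
  have G: "filter_on X ?G" using H by (rule filter_on_filtermap) (use s in auto)
  have section_id: "filtermap (\<lambda>y. \<phi> (q (s y))) H = H"
    using filtermap_cong_eventually[OF eventually_mono[OF evY s(2)]]
    by (simp add: filtermap_ident)
  have inv_image: "filtermap (inv_into Z \<phi>) H = filtermap q ?G"
    unfolding filtermap_filtermap
    by (rule filtermap_cong_eventually, rule eventually_mono[OF evY inv])
  show "inv_into Z \<phi> ` lmY H \<subseteq> quotient_lim X lmX q (filtermap (inv_into Z \<phi>) H)"
  proof
    fix z assume "z \<in> inv_into Z \<phi> ` lmY H"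
    then obtain y where y: "y \<in> lmY H" "z = inv_into Z \<phi> y" by blast
    then have yY: "y \<in> Y" using Y H by (auto simp: convergence_on_def)
    have "s y \<in> lmX ?G"
      using initial[OF s(1)[OF yY] G] y(1) by (simp add: filtermap_filtermap section_id s(2)[OF yY])
    then show "z \<in> quotient_lim X lmX q (filtermap (inv_into Z \<phi>) H)"
      unfolding quotient_lim_def inv_image using G y(2) inv[OF yY] by blast
  qed
qed

section \<open>The embedding by point closures\<close>

lemma irreducible_closed_closure_of_sing:
  assumes "x \<in> topspace T"
  shows "irreducible_closed T (T closure_of {x})"
proof -
  have x: "x \<in> T closure_of {x}" using assms closure_of_subset[of "{x}" T] by blast
  have "T closure_of {x} \<subseteq> D \<longleftrightarrow> x \<in> D" if "closedin T D" for D
    using x that closure_of_minimal[of "{x}" D T] by blast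
  then show ?thesis
    unfolding irreducible_closed_def using x closedin_closure_of[of T "{x}"] by auto
qed

text \<open>
  The preimage of the basic open set of \<open>V\<close> under the point closure map is \<open>V\<close> itself. Continuity,
  openness onto the image and density of that map all follow from this.
\<close>

lemma closure_of_sing_in_sob_open:
  assumes "x \<in> topspace T" "openin T V"
  shows "T closure_of {x} \<in> sob_open T V \<longleftrightarrow> x \<in> V"
proof -
  have "T closure_of {x} \<inter> V \<noteq> {} \<longleftrightarrow> x \<in> V"
    using openin_Int_closure_of_eq_empty[OF assms(2), of "{x}"] by blast
  then show ?thesis
    by (simp add: sob_open_def irreducible_closed_closure_of_sing[OF assms(1)])
qed

lemma dense_embedding_sobrification:
  assumes "t0_space T"
  shows "dense_embedding T (sobrification T) (\<lambda>x. T closure_of {x})"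
proof -
  let ?e = "\<lambda>x. T closure_of {x}" and ?S = "sobrification T"
  have maps: "?e \<in> topspace T \<rightarrow> topspace ?S"
    by (auto simp: topspace_sobrification irreducible_closed_closure_of_sing)
  have "continuous_map T ?S ?e"
    unfolding continuous_map_def
  proof (intro conjI maps allI impI)
    fix W assume "openin ?S W"
    then obtain V where V: "openin T V" "W = sob_open T V" by (auto simp: openin_sobrification)
    then have "{x \<in> topspace T. ?e x \<in> W} = V"
      using openin_subset[OF V(1)] by (auto simp: closure_of_sing_in_sob_open)
    with V(1) show "openin T {x \<in> topspace T. ?e x \<in> W}" by simp
  qed
  moreover have "open_map T (subtopology ?S (?e ` topspace T)) ?e"
    unfolding open_map_def
  proof (intro allI impI)
    fix V assume V: "openin T V"
    then have "?e ` V = sob_open T V \<inter> ?e ` topspace T"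
      using openin_subset[OF V] by (auto simp: closure_of_sing_in_sob_open)
    with V show "openin (subtopology ?S (?e ` topspace T)) (?e ` V)"
      by (auto simp: openin_subtopology openin_sobrification)
  qed
  moreover have "inj_on ?e (topspace T)"
    using assms by (auto simp: t0_space_closure_of_sing inj_on_def)
  ultimately have "embedding_map T ?S ?e"
    unfolding embedding_map_def using maps
    by (intro bijective_open_imp_homeomorphic_map)
      (auto simp: continuous_map_in_subtopology)
  moreover have "?S closure_of (?e ` topspace T) = topspace ?S"
  proof -
    have "\<exists>y. y \<in> ?e ` topspace T \<and> y \<in> W" if CW: "C \<in> W" "openin ?S W" for C W
    proof -
      obtain V where V: "openin T V" "W = sob_open T V"
        using CW by (auto simp: openin_sobrification)
      then obtain x where x: "x \<in> V" using CW by (auto simp: sob_open_def)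
      then have "x \<in> topspace T" using openin_subset[OF V(1)] by blast
      moreover from this x have "?e x \<in> W" using V by (simp add: closure_of_sing_in_sob_open)
      ultimately show ?thesis by blast
    qed
    then show ?thesis by (auto simp: in_closure_of)
  qed
  ultimately show ?thesis by (simp add: dense_embedding_def)
qed

section \<open>The quotient of the points is the sobrification\<close>

lemma mem_pt_proj_iff:
  "W \<in> pt_proj X lm U \<longleftrightarrow> U \<in> pt X lm \<and> W \<in> pt X lm \<and> lm U = lm W"
  by (simp add: pt_proj_def pt_rel_def)

theorem theorem40:
  fixes X :: "'a topology"
  shows "(\<exists>\<phi> :: 'a filter set \<Rightarrow> 'a set.
            (\<forall>U \<in> pt (topspace X) (top_lim X).
               \<phi> (pt_proj (topspace X) (top_lim X) U) = top_lim X U) \<and>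
            conv_homeomorphism
              (pt' (topspace X) (top_lim X)) (pt'_lim (topspace X) (top_lim X))
              (topspace (sobrification X)) (top_lim (sobrification X)) \<phi> \<and>
            (\<forall>x \<in> topspace X.
               principal {x} \<in> pt (topspace X) (top_lim X) \<and>
               \<phi> (pt_proj (topspace X) (top_lim X) (principal {x})) = X closure_of {x})) \<and>
         (t0_space X \<longrightarrow>
            dense_embedding X (sobrification X) (\<lambda>x. X closure_of {x}))"
proof (intro conjI impI dense_embedding_sobrification)
  let ?pt = "top_pt X" and ?q = "pt_proj (topspace X) (top_lim X)"
  let ?S = "sobrification X"
  \<comment> \<open>A class is sent to the limit set of a representative; all of its members share it.\<close>
  define \<phi> where "\<phi> z = top_lim X (SOME U. U \<in> z)" for z
  have \<phi>: "\<phi> (?q U) = top_lim X U" if "U \<in> ?pt" for U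
  proof -
    have "U \<in> ?q U" using that by (simp add: mem_pt_proj_iff)
    then have "(SOME W. W \<in> ?q U) \<in> ?q U" by (rule someI)
    then have "top_lim X U = top_lim X (SOME W. W \<in> ?q U)"
      by (rule mem_pt_proj_iff[THEN iffD1, THEN conjunct2, THEN conjunct2])
    then show ?thesis by (simp only: \<phi>_def)
  qed
  have q_eq: "?q U = ?q W" if "top_lim X U = top_lim X W" "U \<in> ?pt" "W \<in> ?pt" for U W
    using that unfolding set_eq_iff mem_pt_proj_iff by simp
  have bij: "bij_betw \<phi> (pt' (topspace X) (top_lim X)) (topspace ?S)"
    unfolding bij_betw_def pt_proj_image[symmetric]
  proof
    show "inj_on \<phi> (?q ` ?pt)"
    proof (rule inj_onI)
      fix z w assume "z \<in> ?q ` ?pt" "w \<in> ?q ` ?pt" and eq: "\<phi> z = \<phi> w"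
      then obtain U W where "U \<in> ?pt" "z = ?q U" "W \<in> ?pt" "w = ?q W" by blast
      with eq show "z = w" using q_eq[of U W] by (simp add: \<phi>)
    qed
    show "\<phi> ` ?q ` ?pt = topspace ?S"
    proof
      show "\<phi> ` ?q ` ?pt \<subseteq> topspace ?S"
        by (auto simp: \<phi> topspace_sobrification irreducible_closed_top_lim)
      show "topspace ?S \<subseteq> \<phi> ` ?q ` ?pt"
      proof
        fix C assume "C \<in> topspace ?S"
        then obtain U where "U \<in> ?pt" "top_lim X U = C"
          by (auto simp: topspace_sobrification elim: irreducible_closed_is_top_lim)
        then show "C \<in> \<phi> ` ?q ` ?pt" using \<phi> by blast
      qed
    qed
  qed
  have "conv_homeomorphism (pt' (topspace X) (top_lim X)) (pt'_lim (topspace X) (top_lim X))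
          (topspace ?S) (top_lim ?S) \<phi>"
    unfolding pt'_lim_def
  proof (rule conv_homeomorphism_quotient_of_initial)
    fix U \<FF> assume U: "U \<in> ?pt" and \<FF>: "filter_on ?pt \<FF>"
    have pt: "eventually (\<lambda>U. U \<in> ?pt) \<FF>"
      using \<FF> by (simp add: filter_on_def le_principal)
    have "filtermap (\<lambda>U. \<phi> (?q U)) \<FF> = filtermap (top_lim X) \<FF>"
      by (rule filtermap_cong_eventually, rule eventually_mono[OF pt \<phi>])
    then show "U \<in> pt_lim (topspace X) (top_lim X) \<FF> \<longleftrightarrow>
        \<phi> (?q U) \<in> top_lim ?S (filtermap (\<lambda>U. \<phi> (?q U)) \<FF>)"
      using mem_pt_lim_iff[OF U \<FF>] \<phi>[OF U] by simp
  qed (rule convergence_on_top_lim convergence_on_pt_lim pt_proj_image bij)+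
  moreover have "principal {x} \<in> ?pt" if "x \<in> topspace X" for x
    using that closure_of_subset[of "{x}" X]
    by (auto simp: pt_def ultrafilter_on_principal top_lim_principal eventually_principal)
  ultimately show "\<exists>\<phi>. (\<forall>U \<in> ?pt. \<phi> (?q U) = top_lim X U) \<and>
      conv_homeomorphism (pt' (topspace X) (top_lim X)) (pt'_lim (topspace X) (top_lim X))
        (topspace ?S) (top_lim ?S) \<phi> \<and>
      (\<forall>x \<in> topspace X. principal {x} \<in> ?pt \<and> \<phi> (?q (principal {x})) = X closure_of {x})"
    using \<phi> by (intro exI[of _ \<phi>]) (simp add: top_lim_principal)
qed

end
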